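(* Let $X$ be a set with a chosen non-empty collection $\mathcal{U}$ of subsets of $X$, closed under finite intersections and finite unions (in particular, $\mathcal{U}$ contains $X$ and $\varnothing$). (a) The spectral closure $\overline{X}^{\mathcal{U}}$ of $X$ with respect to $\mathcal{U}$ exists (and is unique up to unique homeomorphism compatible with the maps $X\to\overline{X}^{\mathcal{U}}$). (b) Let $i\colon X\to X'$ be a function (of sets) to a spectral space $X'$ and suppose that $\mathcal{U}=\{\,i^{-1}(U) : U\subseteq X' \text{ quasi-compact open}\,\}$. Then the spectral closure $\overline{X}^{\mathcal{U}}$ can be realized as the closure $\overline{\mathrm{Im}(i)}^{\mathrm{con}}$ of the image of $i$ in $X'$ for the constructible topology (viewed as a subspace of the spectral space $X'$, together with the map $X\to\overline{\mathrm{Im}(i)}^{\mathrm{con}}$ obtained by corestricting $i$).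
   Context: A spectral space is a quasi-compact sober ($T_0$, every irreducible closed subset has a generic point) topological space whose quasi-compact open subsets form a basis closed under finite intersections. A map between spectral spaces is spectral if preimages of quasi-compact opens are quasi-compact open. The constructible (or patch) topology on a spectral space $X'$ is the topology generated by the quasi-compact open subsets and their complements. Given $(X,\mathcal{U})$ as in the claim, a map $f\colon X\to X'$ to a spectral space $X'$ is called spectral (with respect to $\mathcal{U}$) if $f^{-1}(U)\in\mathcal{U}$ for every quasi-compact open $U\subseteq X'$. The spectral closure $\overline{X}^{\mathcal{U}}$ of $X$ with respect to $\mathcal{U}$ is the initial spectral map $f\colon X\to\overline{X}^{\mathcal{U}}$ to a spectral space: $f$ is spectral with respect to $\mathcal{U}$, and any other map $f'\colon X\to X'$ to a spectral space that is spectral with respect to $\mathcal{U}$ factors as $f'=\bar f'\circ f$ for a unique spectral map $\bar f'\colon\overline{X}^{\mathcal{U}}\to X'$. *)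

theory Defs
  imports "HOL-Analysis.Analysis"
begin

definition compact_openin :: "'a topology \<Rightarrow> 'a set \<Rightarrow> bool" where
  "compact_openin T V \<longleftrightarrow> openin T V \<and> compactin T V"

definition irreducible_closedin :: "'a topology \<Rightarrow> 'a set \<Rightarrow> bool" where
  "irreducible_closedin T C \<longleftrightarrow>
     closedin T C \<and> C \<noteq> {} \<and>
     (\<forall>A B. closedin T A \<and> closedin T B \<and> C = A \<union> B \<longrightarrow> C = A \<or> C = B)"

definition sober_space :: "'a topology \<Rightarrow> bool" where
  "sober_space T \<longleftrightarrow>
     t0_space T \<and>
     (\<forall>C. irreducible_closedin T C \<longrightarrow> (\<exists>x\<in>topspace T. C = T closure_of {x}))"

(* The empty intersection of compact open sets is the whole space, which is covered by
   compact_space; hence binary intersections suffice below. *)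
definition spectral_space :: "'a topology \<Rightarrow> bool" where
  "spectral_space T \<longleftrightarrow>
     compact_space T \<and> sober_space T \<and>
     openin T = arbitrary union_of (compact_openin T) \<and>
     (\<forall>V W. compact_openin T V \<and> compact_openin T W \<longrightarrow> compact_openin T (V \<inter> W))"

definition spectral_map :: "'a topology \<Rightarrow> 'b topology \<Rightarrow> ('a \<Rightarrow> 'b) \<Rightarrow> bool" where
  "spectral_map S T f \<longleftrightarrow>
     f \<in> topspace S \<rightarrow> topspace T \<and>
     (\<forall>V. compact_openin T V \<longrightarrow> compact_openin S {x \<in> topspace S. f x \<in> V})"

definition constructible_topology :: "'a topology \<Rightarrow> 'a topology" where
  "constructible_topology T =
     topology_generated_by
       ({V. compact_openin T V} \<union> {topspace T - V | V. compact_openin T V})"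

definition spectral_wrt :: "'a set \<Rightarrow> 'a set set \<Rightarrow> 'b topology \<Rightarrow> ('a \<Rightarrow> 'b) \<Rightarrow> bool" where
  "spectral_wrt X \<U> T f \<longleftrightarrow>
     f \<in> X \<rightarrow> topspace T \<and>
     (\<forall>V. compact_openin T V \<longrightarrow> {x \<in> X. f x \<in> V} \<in> \<U>)"

(* The universal property quantifies over spectral spaces on all types, which cannot be done
   inside a formula: the carrier type 'c of the test spaces is a parameter, to be generalized
   at theorem level. Uniqueness of the factorization is uniqueness as a function on topspace Y,
   expressed through the extensional function space. *)
definition is_spectral_closure ::
    "'c itself \<Rightarrow> 'a set \<Rightarrow> 'a set set \<Rightarrow> 'b topology \<Rightarrow> ('a \<Rightarrow> 'b) \<Rightarrow> bool" where
  "is_spectral_closure _ X \<U> Y f \<longleftrightarrow>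
     spectral_space Y \<and> spectral_wrt X \<U> Y f \<and>
     (\<forall>(Z :: 'c topology) f'. spectral_space Z \<and> spectral_wrt X \<U> Z f' \<longrightarrow>
        (\<exists>!g. g \<in> topspace Y \<rightarrow>\<^sub>E topspace Z \<and> spectral_map Y Z g \<and> (\<forall>x\<in>X. f' x = g (f x))))"

(* A space with map chosen independently of any further test type 'c, so that
   "one space is universal for the spectral spaces on every type" can be stated. A carrier of
   type 'a set set has room for the families of members of \<U> (e.g. its prime filters). The
   choice uses only test spaces on that type; being universal for all other types is a claim
   about the chosen pair, not part of its definition. *)
definition spectral_closure_pair ::
    "'a set \<Rightarrow> 'a set set \<Rightarrow> 'a set set topology \<times> ('a \<Rightarrow> 'a set set)" where
  "spectral_closure_pair X \<U> =
     (SOME p. is_spectral_closure TYPE('a set set) X \<U> (fst p) (snd p))"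

definition spectral_closure :: "'a set \<Rightarrow> 'a set set \<Rightarrow> 'a set set topology" where
  "spectral_closure X \<U> = fst (spectral_closure_pair X \<U>)"

definition spectral_closure_map :: "'a set \<Rightarrow> 'a set set \<Rightarrow> 'a \<Rightarrow> 'a set set" where
  "spectral_closure_map X \<U> = snd (spectral_closure_pair X \<U>)"

end

theory Submission
  imports Defs
begin

text \<open>
  A spectral space is determined by its lattice of quasi-compact open sets: its points are the
  prime filters of that lattice. Hence \<open>(Y, f)\<close> is a spectral closure as soon as taking preimages
  under \<open>f\<close> is a bijection from the quasi-compact opens of \<open>Y\<close> onto \<open>\<U>\<close>. The space of prime
  filters of \<open>\<U>\<close> has this property, and so does the constructible closure of the image of \<open>i\<close>:
  a prime filter on its traces of quasi-compact opens comes from a point of \<open>X'\<close>, every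
  constructible neighbourhood \<open>V - W\<close> of which meets that closure.
\<close>

section \<open>Prime filters of a lattice of sets\<close>

text \<open>Compactness and sobriety would have to be proved for both candidate spaces. Both are
  covered by one criterion: a T0 space with a lattice of basic opens, each of whose prime filters is
  realised by a point. Such a point serves twice: it lies outside a family of opens that has no
  finite subcover, and it is generic in an irreducible closed set. Zorn's lemma is used once, to
  produce the prime filter for the compactness argument.

  In the bijection between quasi-compact opens of \<open>Y\<close> and \<U>, surjectivity gives
  every quasi-compact open of a test space a counterpart in \<open>Y\<close>. Injectivity makes
  these counterparts respect unions and intersections, and makes the factorization unique.

  A further obstacle is that universality is relative to the carrier type of the test spaces. The
  pair chosen in \<open>spectral_closure_pair\<close> is known to be universal for one type only; it
  inherits universality for every other type from the space of prime filters, to which it is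
  isomorphic.\<close>

definition set_lattice :: "'a set \<Rightarrow> 'a set set \<Rightarrow> bool" where
  "set_lattice S B \<longleftrightarrow> B \<subseteq> Pow S \<and> S \<in> B \<and> {} \<in> B \<and>
     (\<forall>u\<in>B. \<forall>v\<in>B. u \<inter> v \<in> B \<and> u \<union> v \<in> B)"

text \<open>On a lattice \<open>B\<close>, the conditions say that membership in \<open>P\<close> is
  a homomorphism of bounded lattices from \<open>B\<close> to the truth values. Upward closure is
  contained in the equivalence for intersections, since \<open>u \<inter> v = u\<close> when
  \<open>u \<subseteq> v\<close>.\<close>

definition prime_filter :: "'a set \<Rightarrow> 'a set set \<Rightarrow> 'a set set \<Rightarrow> bool" where
  "prime_filter S B P \<longleftrightarrow> P \<subseteq> B \<and> S \<in> P \<and> {} \<notin> P \<and>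
     (\<forall>u\<in>B. \<forall>v\<in>B. (u \<inter> v \<in> P \<longleftrightarrow> u \<in> P \<and> v \<in> P) \<and> (u \<union> v \<in> P \<longleftrightarrow> u \<in> P \<or> v \<in> P))"

lemma set_lattice_Union:
  assumes "set_lattice S B" "finite F" "F \<subseteq> B"
  shows "\<Union>F \<in> B"
  using assms(2,3) by (induction F rule: finite_induct) (use assms(1) in \<open>auto simp: set_lattice_def\<close>)

lemma prime_filter_mono:
  assumes "prime_filter S B P" "u \<in> P" "v \<in> B" "u \<subseteq> v"
  shows "v \<in> P"
proof -
  have "u \<in> B" "u \<inter> v = u"
    using assms by (auto simp: prime_filter_def)
  then show ?thesis
    using assms unfolding prime_filter_def by metis
qed

lemma prime_filter_Union:
  assumes "set_lattice S B" "prime_filter S B P" "finite F" "F \<subseteq> B"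
  shows "\<Union>F \<in> P \<longleftrightarrow> (\<exists>u\<in>F. u \<in> P)"
  using assms(3,4)
proof (induction F rule: finite_induct)
  case empty
  then show ?case using assms(2) by (auto simp: prime_filter_def)
next
  case (insert u F)
  then have "\<Union>F \<in> B" "u \<in> B"
    using set_lattice_Union[OF assms(1)] by auto
  then have "u \<union> \<Union>F \<in> P \<longleftrightarrow> u \<in> P \<or> \<Union>F \<in> P"
    using assms(2) by (simp add: prime_filter_def)
  then show ?case using insert by simp
qed

text \<open>The prime filter is the complement of a maximal family containing \<open>C\<close> that does not
  finitely cover \<open>u\<close>; no passage to ideals is needed.\<close>
lemma prime_filter_avoiding:
  assumes B: "set_lattice S B" and u: "u \<in> B" and C: "C \<subseteq> B"
    and nc: "\<And>F. finite F \<Longrightarrow> F \<subseteq> C \<Longrightarrow> \<not> u \<subseteq> \<Union>F"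
  obtains P where "prime_filter S B P" "u \<in> P" "P \<inter> C = {}"
proof -
  define A where "A = {D. C \<subseteq> D \<and> D \<subseteq> B \<and> (\<forall>F. finite F \<and> F \<subseteq> D \<longrightarrow> \<not> u \<subseteq> \<Union>F)}"
  have "\<exists>M\<in>A. \<forall>D\<in>A. M \<subseteq> D \<longrightarrow> D = M"
  proof (rule subset_Zorn_nonempty)
    show "A \<noteq> {}" using C nc by (auto simp: A_def)
    fix \<C> assume ne: "\<C> \<noteq> {}" and ch: "subset.chain A \<C>"
    then have sub: "\<C> \<subseteq> A" by (auto simp: subset.chain_def)
    have "\<not> u \<subseteq> \<Union>F" if F: "finite F" "F \<subseteq> \<Union>\<C>" for F
    proof -
      obtain D where "D \<in> \<C>" "F \<subseteq> D"
        using finite_subset_Union_chain[OF F ne ch] by blast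
      then show ?thesis using sub F by (auto simp: A_def)
    qed
    moreover have "C \<subseteq> D" "D \<subseteq> B" if "D \<in> \<C>" for D
      using that sub by (auto simp: A_def)
    then have "C \<subseteq> \<Union>\<C>" "\<Union>\<C> \<subseteq> B" using ne by blast+
    ultimately show "\<Union>\<C> \<in> A" unfolding A_def by blast
  qed
  then obtain M where M: "M \<in> A" and max: "\<And>D. D \<in> A \<Longrightarrow> M \<subseteq> D \<Longrightarrow> D = M" by blast
  have MB: "M \<subseteq> B" "C \<subseteq> M" and Mnc: "\<And>F. finite F \<Longrightarrow> F \<subseteq> M \<Longrightarrow> \<not> u \<subseteq> \<Union>F"
    using M by (auto simp: A_def)
  \<comment> \<open>By maximality, \<open>w\<close> is outside \<open>M\<close> exactly when adding
    it to \<open>M\<close> creates a finite cover of \<open>u\<close>. The filter laws below become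
    manipulations of such covers: two of them are merged for intersections, and for unions one is
    completed by \<open>v\<close> and \<open>w\<close>.\<close>
  have iff: "w \<in> B - M \<longleftrightarrow> (\<exists>F. finite F \<and> F \<subseteq> M \<and> u \<subseteq> w \<union> \<Union>F)" if w: "w \<in> B" for w
  proof
    assume "w \<in> B - M"
    then have "insert w M \<notin> A" using max[of "insert w M"] by auto
    then obtain F where F: "finite F" "F \<subseteq> insert w M" "u \<subseteq> \<Union>F"
      using MB w by (auto simp: A_def)
    then have "finite (F - {w})" "F - {w} \<subseteq> M" "u \<subseteq> w \<union> \<Union>(F - {w})" by auto
    then show "\<exists>F. finite F \<and> F \<subseteq> M \<and> u \<subseteq> w \<union> \<Union>F" by blast
  next
    assume "\<exists>F. finite F \<and> F \<subseteq> M \<and> u \<subseteq> w \<union> \<Union>F"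
    then obtain F where "finite F" "F \<subseteq> M" "u \<subseteq> w \<union> \<Union>F" by blast
    then show "w \<in> B - M" using Mnc[of "insert w F"] w by auto
  qed
  have up: "w \<in> B - M" if "v \<in> B - M" "w \<in> B" "v \<subseteq> w" for v w
    using that iff[of v] iff[of w] by blast
  have cl: "v \<inter> w \<in> B" "v \<union> w \<in> B" if "v \<in> B" "w \<in> B" for v w
    using B that by (auto simp: set_lattice_def)
  have int: "v \<inter> w \<in> B - M" if v: "v \<in> B - M" and w: "w \<in> B - M" for v w
  proof -
    obtain F G where "finite F" "F \<subseteq> M" "u \<subseteq> v \<union> \<Union>F" "finite G" "G \<subseteq> M" "u \<subseteq> w \<union> \<Union>G"
      using iff[of v] iff[of w] v w by blast
    then have "finite (F \<union> G)" "F \<union> G \<subseteq> M" "u \<subseteq> (v \<inter> w) \<union> \<Union>(F \<union> G)" by auto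
    then show ?thesis using iff[of "v \<inter> w"] cl v w by blast
  qed
  have un: "v \<in> B - M \<or> w \<in> B - M" if v: "v \<in> B" and w: "w \<in> B" and vw: "v \<union> w \<in> B - M" for v w
  proof (rule ccontr)
    assume *: "\<not> ?thesis"
    obtain F where "finite F" "F \<subseteq> M" "u \<subseteq> (v \<union> w) \<union> \<Union>F"
      using iff[of "v \<union> w"] vw by blast
    then have "finite (insert v (insert w F))" "insert v (insert w F) \<subseteq> M"
      "u \<subseteq> \<Union>(insert v (insert w F))" using * v w by auto
    then show False using Mnc by blast
  qed
  have uM: "u \<in> B - M" using iff[OF u] by (metis Un_upper1 empty_subsetI finite.emptyI)
  have "prime_filter S B (B - M)"
    unfolding prime_filter_def
  proof (intro conjI ballI iffI)
    show "S \<in> B - M" using up[OF uM, of S] B u by (auto simp: set_lattice_def)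
    show "{} \<notin> B - M" using iff[of "{}"] Mnc by (auto)
  next
    fix v w assume "v \<in> B" "w \<in> B" "v \<union> w \<in> B - M"
    then show "v \<in> B - M \<or> w \<in> B - M" by (rule un)
  next
    fix v w assume "v \<in> B" "w \<in> B" "v \<in> B - M \<or> w \<in> B - M"
    then show "v \<union> w \<in> B - M" using up cl by (meson Un_upper1 Un_upper2)
  next
    fix v w assume "v \<in> B" "w \<in> B" "v \<in> B - M \<and> w \<in> B - M"
    then show "v \<inter> w \<in> B - M" by (simp only: int)
  qed (use up in \<open>blast+\<close>)
  then show ?thesis using that uM MB by blast
qed

section \<open>Spectral spaces and prime filters\<close>

lemma spectral_space_set_lattice:
  assumes "spectral_space T"
  shows "set_lattice (topspace T) {V. compact_openin T V}"
proof -
  have "compactin T (topspace T)"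
    "\<And>V W. compact_openin T V \<Longrightarrow> compact_openin T W \<Longrightarrow> compact_openin T (V \<inter> W)"
    using assms unfolding spectral_space_def compact_space_def by blast+
  then show ?thesis
    by (auto simp: set_lattice_def compact_openin_def intro: compactin_Un dest: openin_subset)
qed

lemma spectral_space_basis:
  assumes "spectral_space T" "openin T V" "x \<in> V"
  obtains W where "compact_openin T W" "x \<in> W" "W \<subseteq> V"
proof -
  have "(arbitrary union_of compact_openin T) V"
    using assms by (metis spectral_space_def)
  then show thesis using assms(3) that by (auto simp: union_of_def)
qed

lemma spectral_space_eqI:
  assumes T: "spectral_space T" and xy: "x \<in> topspace T" "y \<in> topspace T"
    and eq: "\<And>V. compact_openin T V \<Longrightarrow> x \<in> V \<longleftrightarrow> y \<in> V"
  shows "x = y"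
proof (rule ccontr)
  assume "x \<noteq> y"
  then obtain U where "openin T U" "\<not> (x \<in> U \<longleftrightarrow> y \<in> U)"
    using T xy unfolding spectral_space_def sober_space_def t0_space_def by blast
  then show False by (metis T eq spectral_space_basis in_mono)
qed

text \<open>Remove from the space all quasi-compact opens outside \<open>P\<close>. The remaining
  closed set \<open>C\<close> meets exactly the members of \<open>P\<close> among the quasi-compact
  opens. Closure of \<open>P\<close> under intersections makes \<open>C\<close> irreducible, and its
  generic point is the point sought.\<close>

lemma spectral_space_prime_filter_point:
  assumes T: "spectral_space T" and P: "prime_filter (topspace T) {V. compact_openin T V} P"
  obtains z where "z \<in> topspace T" "\<And>V. compact_openin T V \<Longrightarrow> z \<in> V \<longleftrightarrow> V \<in> P"
proof -
  note L = spectral_space_set_lattice[OF T]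
  define N where "N = {V. compact_openin T V \<and> V \<notin> P}"
  define C where "C = topspace T - \<Union>N"
  have clC: "closedin T C"
    unfolding C_def N_def compact_openin_def by blast
  have meets: "V \<inter> C \<noteq> {} \<longleftrightarrow> V \<in> P" if V: "compact_openin T V" for V
  proof
    assume "V \<inter> C \<noteq> {}"
    then show "V \<in> P" using V by (auto simp: C_def N_def)
  next
    assume VP: "V \<in> P"
    show "V \<inter> C \<noteq> {}"
    proof
      \<comment> \<open>By compactness finitely many quasi-compact opens outside \<open>P\<close>
        would cover \<open>V\<close>; their union would lie in \<open>P\<close>, so primality would
        put one of them in \<open>P\<close>.\<close>
      assume "V \<inter> C = {}"
      then have "V \<subseteq> \<Union>N"
        using V openin_subset by (fastforce simp: C_def compact_openin_def)
      moreover have "compactin T V" "\<And>W. W \<in> N \<Longrightarrow> openin T W"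
        using V by (auto simp: N_def compact_openin_def)
      ultimately obtain F where F: "finite F" "F \<subseteq> N" "V \<subseteq> \<Union>F"
        by (metis compactinD)
      then have FB: "F \<subseteq> {V. compact_openin T V}" by (auto simp: N_def)
      have "\<Union>F \<in> P"
        using prime_filter_mono[OF P VP set_lattice_Union[OF L F(1) FB] F(3)] .
      then show False
        using prime_filter_Union[OF L P F(1) FB] F(2) by (auto simp: N_def)
    qed
  qed
  have "irreducible_closedin T C"
    unfolding irreducible_closedin_def
  proof (intro conjI allI impI)
    have "topspace T \<in> P" using P by (simp add: prime_filter_def)
    then show "C \<noteq> {}" using meets[of "topspace T"] P by (auto simp: prime_filter_def)
    fix A A' assume A: "closedin T A \<and> closedin T A' \<and> C = A \<union> A'"
    show "C = A \<or> C = A'"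
    proof (rule ccontr)
      assume "\<not> ?thesis"
      then obtain x x' where x: "x \<in> C" "x \<notin> A" "x' \<in> C" "x' \<notin> A'" using A by blast
      then have "x \<in> topspace T - A" "x' \<in> topspace T - A'"
        "openin T (topspace T - A)" "openin T (topspace T - A')"
        using clC A closedin_subset by blast+
      then obtain W W' where W: "compact_openin T W" "x \<in> W" "W \<subseteq> topspace T - A"
        "compact_openin T W'" "x' \<in> W'" "W' \<subseteq> topspace T - A'"
        by (metis T spectral_space_basis)
      then have "W \<in> P" "W' \<in> P" using meets x by blast+
      then have "W \<inter> W' \<in> P" using P W by (simp add: prime_filter_def)
      then have "W \<inter> W' \<inter> C \<noteq> {}" using meets[of "W \<inter> W'"] P by (auto simp: prime_filter_def)
      then show False using A W by blast
    qed
  qed (rule clC)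
  then obtain z where z: "z \<in> topspace T" "C = T closure_of {z}"
    using T unfolding spectral_space_def sober_space_def by blast
  have "z \<in> V \<longleftrightarrow> V \<in> P" if V: "compact_openin T V" for V
  proof -
    \<comment> \<open>An open set meets the closure of \<open>{z}\<close> exactly when it contains
      \<open>z\<close>.\<close>
    have "V \<inter> C \<noteq> {} \<longleftrightarrow> z \<in> V"
      using V openin_Int_closure_of_eq_empty[of T V "{z}"] by (auto simp: z(2) compact_openin_def)
    then show ?thesis using meets[OF V] by simp
  qed
  with z(1) show ?thesis by (rule that)
qed

text \<open>A converse to the realisation of prime filters by points. A prime filter containing
  \<open>u\<close> and avoiding the small basic sets of a cover yields a point of \<open>u\<close>
  that the cover misses, whence compactness. The basic sets that meet an irreducible closed set form
  a prime filter, whose point is generic, whence sobriety.\<close>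

lemma
  assumes op: "openin T = arbitrary union_of (\<lambda>u. u \<in> B)" and B: "set_lattice (topspace T) B"
    and t0: "\<And>x y. x \<in> topspace T \<Longrightarrow> y \<in> topspace T \<Longrightarrow> (\<And>u. u \<in> B \<Longrightarrow> x \<in> u \<longleftrightarrow> y \<in> u) \<Longrightarrow> x = y"
    and pt: "\<And>P. prime_filter (topspace T) B P \<Longrightarrow> \<exists>z\<in>topspace T. \<forall>u\<in>B. z \<in> u \<longleftrightarrow> u \<in> P"
  shows spectral_space_of_prime_filters: "spectral_space T"
    and compact_openin_of_prime_filters: "compact_openin T V \<longleftrightarrow> V \<in> B"
proof -
  have opB: "openin T u" if "u \<in> B" for u
    using that op by (metis arbitrary_union_of_inc)
  have basis: "\<exists>u\<in>B. x \<in> u \<and> u \<subseteq> V" if "openin T V" "x \<in> V" for V x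
    using that by (auto simp: op union_of_def)
  have comp: "compactin T u" if u: "u \<in> B" for u
    unfolding compactin_def
  proof (intro conjI allI impI)
    show "u \<subseteq> topspace T" using u B by (auto simp: set_lattice_def)
    fix \<C> assume \<C>: "Ball \<C> (openin T) \<and> u \<subseteq> \<Union>\<C>"
    \<comment> \<open>The cover need not consist of members of \<open>B\<close>, so it is refined to
      the basic sets below its members; prime filters can avoid only the latter.\<close>
    define D where "D = {v\<in>B. \<exists>c\<in>\<C>. v \<subseteq> c}"
    have "\<exists>F. finite F \<and> F \<subseteq> D \<and> u \<subseteq> \<Union>F"
    proof (rule ccontr)
      assume "\<nexists>F. finite F \<and> F \<subseteq> D \<and> u \<subseteq> \<Union>F"
      then have nc: "\<not> u \<subseteq> \<Union>F" if "finite F" "F \<subseteq> D" for F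
        using that by simp
      have DB: "D \<subseteq> B" by (auto simp: D_def)
      obtain P where P: "prime_filter (topspace T) B P" "u \<in> P" "P \<inter> D = {}"
        by (rule prime_filter_avoiding[OF B u DB nc])
      then obtain z where z: "\<forall>v\<in>B. z \<in> v \<longleftrightarrow> v \<in> P" using pt by blast
      then have "z \<in> u" using u P by blast
      then obtain c where "c \<in> \<C>" "z \<in> c" "openin T c" using \<C> by blast
      then obtain v where "v \<in> B" "z \<in> v" "v \<subseteq> c" using basis by blast
      then show False using z P \<open>c \<in> \<C>\<close> by (auto simp: D_def)
    qed
    then obtain F where F: "finite F" "F \<subseteq> D" "u \<subseteq> \<Union>F" by blast
    then have "\<forall>v\<in>F. \<exists>c. c \<in> \<C> \<and> v \<subseteq> c" by (auto simp: D_def)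
    then obtain c where c: "\<forall>v\<in>F. c v \<in> \<C> \<and> v \<subseteq> c v" by (rule exE[OF bchoice])
    have "\<Union>F \<subseteq> \<Union>(c ` F)" using c by (intro Union_least) (meson UN_upper subset_trans)
    then have "u \<subseteq> \<Union>(c ` F)" by (rule subset_trans[OF F(3)])
    moreover have "finite (c ` F)" "c ` F \<subseteq> \<C>" using F(1) c by auto
    ultimately show "\<exists>\<F>. finite \<F> \<and> \<F> \<subseteq> \<C> \<and> u \<subseteq> \<Union>\<F>"
      by (intro exI conjI)
  qed
  have co: "compact_openin T V \<longleftrightarrow> V \<in> B" for V
  proof
    \<comment> \<open>Such a \<open>V\<close> is a union of basic sets, hence by compactness a
      finite one, and \<open>B\<close> is closed under finite unions.\<close>
    assume V: "compact_openin T V"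
    then obtain \<D> where D: "\<D> \<subseteq> B" "\<Union>\<D> = V"
      unfolding compact_openin_def op union_of_def by blast
    then obtain F where F: "finite F" "F \<subseteq> \<D>" "V \<subseteq> \<Union>F"
      using V opB unfolding compact_openin_def by (metis compactinD in_mono subset_refl)
    then have "V = \<Union>F" using D by blast
    then show "V \<in> B" using set_lattice_Union[OF B F(1)] F D by simp
  qed (simp add: compact_openin_def comp opB)
  then show "compact_openin T V \<longleftrightarrow> V \<in> B" .
  have gen: "\<exists>x\<in>topspace T. C = T closure_of {x}" if C: "irreducible_closedin T C" for C
  proof -
    have cl: "closedin T C" and ne: "C \<noteq> {}" and CT: "C \<subseteq> topspace T"
      using C closedin_subset by (auto simp: irreducible_closedin_def)
    have irr: "u \<inter> v \<inter> C \<noteq> {}" if "u \<in> B" "v \<in> B" "u \<inter> C \<noteq> {}" "v \<inter> C \<noteq> {}" for u v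
    proof
      assume "u \<inter> v \<inter> C = {}"
      \<comment> \<open>Two basic sets that meet \<open>C\<close> in disjoint parts would split
        \<open>C\<close> into two proper closed subsets.\<close>
      then have "C = (C - u) \<union> (C - v)" by blast
      moreover have "closedin T (C - u)" "closedin T (C - v)"
        using cl opB that by (auto intro: closedin_diff)
      ultimately have "C = C - u \<or> C = C - v"
        using C unfolding irreducible_closedin_def by blast
      then show False using that by blast
    qed
    define P where "P = {u\<in>B. u \<inter> C \<noteq> {}}"
    have "prime_filter (topspace T) B P"
      unfolding prime_filter_def
    proof (intro conjI ballI)
      show "P \<subseteq> B" "{} \<notin> P" by (auto simp: P_def)
      show "topspace T \<in> P"
        using ne CT B by (simp add: P_def set_lattice_def Int_absorb1)
      fix u v assume uv: "u \<in> B" "v \<in> B"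
      then show "u \<inter> v \<in> P \<longleftrightarrow> u \<in> P \<and> v \<in> P"
        using irr[OF uv] B unfolding P_def set_lattice_def by blast
      show "u \<union> v \<in> P \<longleftrightarrow> u \<in> P \<or> v \<in> P"
        using uv B unfolding P_def set_lattice_def by blast
    qed
    from pt[OF this] obtain z where z: "z \<in> topspace T" "\<And>u. u \<in> B \<Longrightarrow> z \<in> u \<longleftrightarrow> u \<inter> C \<noteq> {}"
      by (auto simp: P_def)
    \<comment> \<open>Otherwise a basic neighbourhood of \<open>z\<close> would miss
      \<open>C\<close>, although by the choice of \<open>z\<close> every basic set around it meets
      \<open>C\<close>.\<close>
    have "z \<in> C"
    proof (rule ccontr)
      assume "z \<notin> C"
      then obtain u where "u \<in> B" "z \<in> u" "u \<subseteq> topspace T - C"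
        using basis[of "topspace T - C" z] cl z(1) by blast
      then show False using z(2) by blast
    qed
    then have "T closure_of {z} \<subseteq> C" using cl by (simp add: closure_of_minimal)
    moreover have "C \<subseteq> T closure_of {z}"
    proof
      fix x assume x: "x \<in> C"
      have "z \<in> V" if V: "openin T V" "x \<in> V" for V
        using basis[OF V] z(2) x by blast
      then show "x \<in> T closure_of {z}" using x CT by (auto simp: in_closure_of)
    qed
    ultimately show ?thesis using z by blast
  qed
  have "t0_space T"
    unfolding t0_space_def using t0 opB by metis
  then have "sober_space T"
    using gen by (simp add: sober_space_def)
  moreover have "compact_openin T = (\<lambda>u. u \<in> B)"
    using co by (intro ext)
  then have "openin T = arbitrary union_of compact_openin T"
    using op by (simp only:)
  moreover have "compact_space T"
    using comp B unfolding compact_space_def set_lattice_def by blast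
  moreover have "\<forall>V W. compact_openin T V \<and> compact_openin T W \<longrightarrow> compact_openin T (V \<inter> W)"
    using B unfolding co set_lattice_def by blast
  ultimately show "spectral_space T"
    unfolding spectral_space_def by (intro conjI)
qed

section \<open>Spectral closures\<close>

lemma spectral_map_id: "spectral_map T T id"
proof -
  have "{x \<in> topspace T. id x \<in> V} = V" if "compact_openin T V" for V
    using that openin_subset by (fastforce simp: compact_openin_def)
  then show ?thesis by (simp add: spectral_map_def)
qed

lemma spectral_map_compose:
  assumes f: "spectral_map R S f" and g: "spectral_map S T g"
    and h: "\<And>x. x \<in> topspace R \<Longrightarrow> h x = g (f x)"
  shows "spectral_map R T h"
proof -
  have "{x \<in> topspace R. h x \<in> V} = {x \<in> topspace R. f x \<in> {y \<in> topspace S. g y \<in> V}}" for V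
    using f h by (auto simp: spectral_map_def)
  then show ?thesis
    using assms by (auto simp: spectral_map_def Pi_iff)
qed

lemma spectral_map_continuous:
  assumes T: "spectral_space T" and f: "spectral_map S T f"
  shows "continuous_map S T f"
  unfolding continuous_map_def
proof (intro conjI allI impI)
  show "f \<in> topspace S \<rightarrow> topspace T" using f by (simp add: spectral_map_def)
  fix U assume U: "openin T U"
  show "openin S {x \<in> topspace S. f x \<in> U}"
  proof (subst openin_subopen, clarify)
    fix x assume x: "x \<in> topspace S" "f x \<in> U"
    obtain W where W: "compact_openin T W" "f x \<in> W" "W \<subseteq> U"
      using spectral_space_basis[OF T U x(2)] .
    then have "openin S {x \<in> topspace S. f x \<in> W}"
      using f by (auto simp: spectral_map_def compact_openin_def)
    then show "\<exists>V. openin S V \<and> x \<in> V \<and> V \<subseteq> {x \<in> topspace S. f x \<in> U}"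
      using W x by blast
  qed
qed

text \<open>This lets the universal property apply to an arbitrary competing homeomorphism between
  two spectral closures.\<close>

lemma homeomorphic_map_spectral:
  assumes "homeomorphic_map S T h"
  shows "spectral_map S T h"
  unfolding spectral_map_def
proof (intro conjI allI impI)
  have im: "h ` topspace S = topspace T"
    using assms homeomorphic_imp_surjective_map by blast
  then show "h \<in> topspace S \<rightarrow> topspace T" by auto
  fix V assume V: "compact_openin T V"
  let ?U = "{x \<in> topspace S. h x \<in> V}"
  have "h ` ?U = V"
    using V im openin_subset by (fastforce simp: compact_openin_def)
  then show "compact_openin S ?U"
    using V homeomorphic_map_openness[OF assms, of ?U] homeomorphic_map_compactness[OF assms, of ?U]
    by (auto simp: compact_openin_def)
qed

section \<open>Uniqueness of spectral closures\<close>

lemma is_spectral_closureD: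
  assumes "is_spectral_closure TYPE('c) X \<U> Y f" "spectral_space (Z :: 'c topology)" "spectral_wrt X \<U> Z f'"
  shows "\<exists>!g. g \<in> topspace Y \<rightarrow>\<^sub>E topspace Z \<and> spectral_map Y Z g \<and> (\<forall>x\<in>X. f' x = g (f x))"
  using assms unfolding is_spectral_closure_def by simp

text \<open>Uniqueness of factorizations is formulated for extensional functions. Restricting both
  maps to \<open>topspace Y\<close> makes it available for composites and identities, which are not
  extensional.\<close>

lemma spectral_wrt_eq_compose:
  assumes "is_spectral_closure TYPE('c) X \<U> Y f" "spectral_space (Z :: 'c topology)" "spectral_wrt X \<U> Z f'"
    "spectral_map Y Z g" "spectral_map Y Z h" "\<And>x. x \<in> X \<Longrightarrow> g (f x) = f' x" "\<And>x. x \<in> X \<Longrightarrow> h (f x) = f' x"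
    "y \<in> topspace Y"
  shows "g y = h y"
proof -
  let ?r = "\<lambda>k. restrict k (topspace Y)"
  let ?Q = "\<lambda>k. k \<in> topspace Y \<rightarrow>\<^sub>E topspace Z \<and> spectral_map Y Z k \<and> (\<forall>x\<in>X. f' x = k (f x))"
  have f: "f \<in> X \<rightarrow> topspace Y"
    using assms(1) by (simp add: is_spectral_closure_def spectral_wrt_def)
  have Q: "?Q (?r k)" if "spectral_map Y Z k" "\<And>x. x \<in> X \<Longrightarrow> k (f x) = f' x" for k
    using that f spectral_map_compose[OF spectral_map_id that(1), of "?r k"]
    by (auto simp: spectral_map_def)
  obtain k where k: "\<forall>k'. ?Q k' \<longrightarrow> k' = k"
    using is_spectral_closureD[OF assms(1-3)] by (rule ex1E)
  note k = mp[OF spec[OF k]]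
  have "?r g = ?r h"
    using k[OF Q[OF assms(4) assms(6)]] k[OF Q[OF assms(5) assms(7)]] by simp
  then show ?thesis using assms(8) by (metis restrict_apply')
qed

text \<open>Each of the four hypotheses pays for one step: \<open>Yd\<close> constructs
  \<open>h\<close>, \<open>Zb\<close> constructs \<open>k\<close>, and \<open>Yb\<close> and
  \<open>Zd\<close> identify the two composites with the identity, each space being tested against
  its own carrier type.\<close>

lemma spectral_closure_iso:
  fixes Y :: "'b topology" and Z :: "'d topology"
  assumes Yb: "is_spectral_closure TYPE('b) X \<U> Y f" and Yd: "is_spectral_closure TYPE('d) X \<U> Y f"
    and Zb: "is_spectral_closure TYPE('b) X \<U> Z g" and Zd: "is_spectral_closure TYPE('d) X \<U> Z g"
  obtains h k where "h \<in> topspace Y \<rightarrow>\<^sub>E topspace Z" "spectral_map Y Z h" "\<And>x. x \<in> X \<Longrightarrow> h (f x) = g x"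
    "spectral_map Z Y k" "\<And>y. y \<in> topspace Y \<Longrightarrow> k (h y) = y" "\<And>z. z \<in> topspace Z \<Longrightarrow> h (k z) = z"
proof -
  have sY: "spectral_space Y" "spectral_wrt X \<U> Y f" and sZ: "spectral_space Z" "spectral_wrt X \<U> Z g"
    using Yb Zb by (auto simp: is_spectral_closure_def)
  obtain h where h: "h \<in> topspace Y \<rightarrow>\<^sub>E topspace Z" "spectral_map Y Z h" "\<And>x. x \<in> X \<Longrightarrow> g x = h (f x)"
    using is_spectral_closureD[OF Yd sZ] by blast
  obtain k where k: "spectral_map Z Y k" "\<And>x. x \<in> X \<Longrightarrow> f x = k (g x)"
    using is_spectral_closureD[OF Zb sY] by blast
  have hf: "h (f x) = g x" and kg: "k (g x) = f x" if "x \<in> X" for x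
    using h(3) k(2) that by simp_all
  have "spectral_map Y Y (\<lambda>y. k (h y))" by (rule spectral_map_compose[OF h(2) k(1)]) simp
  then have kh: "k (h y) = id y" if "y \<in> topspace Y" for y
    by (rule spectral_wrt_eq_compose[OF Yb sY _ spectral_map_id]) (simp_all add: hf kg that)
  have "spectral_map Z Z (\<lambda>z. h (k z))" by (rule spectral_map_compose[OF k(1) h(2)]) simp
  then have hk: "h (k z) = id z" if "z \<in> topspace Z" for z
    by (rule spectral_wrt_eq_compose[OF Zd sZ _ spectral_map_id]) (simp_all add: hf kg that)
  show ?thesis using that[of h k] h(1,2) k(1) hf kh hk by simp
qed

lemma spectral_closure_unique:
  fixes Y :: "'b topology" and Z :: "'d topology"
  assumes "is_spectral_closure TYPE('b) X \<U> Y f" "is_spectral_closure TYPE('d) X \<U> Y f"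
    "is_spectral_closure TYPE('b) X \<U> Z g" "is_spectral_closure TYPE('d) X \<U> Z g"
  shows "\<exists>!h. h \<in> topspace Y \<rightarrow>\<^sub>E topspace Z \<and> homeomorphic_map Y Z h \<and> (\<forall>x\<in>X. g x = h (f x))"
proof -
  obtain h k where h: "h \<in> topspace Y \<rightarrow>\<^sub>E topspace Z" "spectral_map Y Z h" "\<And>x. x \<in> X \<Longrightarrow> h (f x) = g x"
    and k: "spectral_map Z Y k"
    and inv: "\<And>y. y \<in> topspace Y \<Longrightarrow> k (h y) = y" "\<And>z. z \<in> topspace Z \<Longrightarrow> h (k z) = z"
    using spectral_closure_iso[OF assms] by blast
  have sp: "spectral_space Y" "spectral_space Z" "spectral_wrt X \<U> Z g"
    using assms by (auto simp: is_spectral_closure_def)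
  have "homeomorphic_maps Y Z h k"
    using spectral_map_continuous[OF sp(2) h(2)] spectral_map_continuous[OF sp(1) k] inv
    by (simp add: homeomorphic_maps_def)
  then have "homeomorphic_map Y Z h" by (metis homeomorphic_map_maps)
  then show ?thesis
  proof (intro ex1I[of _ h] conjI)
    fix h' assume h': "h' \<in> topspace Y \<rightarrow>\<^sub>E topspace Z \<and> homeomorphic_map Y Z h' \<and> (\<forall>x\<in>X. g x = h' (f x))"
    show "h' = h"
    proof (rule PiE_ext)
      show "h' y = h y" if "y \<in> topspace Y" for y
        using spectral_wrt_eq_compose[OF assms(2) sp(2,3) _ h(2) _ h(3) that] h'
          homeomorphic_map_spectral by metis
    qed (use h h' in auto)
  qed (use h in auto)
qed

text \<open>The map \<open>g\<close> sends \<open>y\<close> to the point of \<open>Z\<close> whose prime filter consists of the \<open>W\<close> such that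
  \<open>y \<in> \<phi> W\<close>, where \<open>\<phi> W\<close> is the quasi-compact open of \<open>Y\<close> with the same trace on \<open>X\<close> as \<open>W\<close>.\<close>
lemma is_spectral_closureI:
  assumes Y: "spectral_space Y" and f: "f \<in> X \<rightarrow> topspace Y"
    and bij: "bij_betw (\<lambda>V. {x \<in> X. f x \<in> V}) {V. compact_openin Y V} \<U>"
  shows "is_spectral_closure TYPE('c) X \<U> Y f"
  unfolding is_spectral_closure_def
proof (intro conjI allI impI)
  show "spectral_wrt X \<U> Y f"
    using f bij_betwE[OF bij] by (auto simp: spectral_wrt_def)
  fix Z :: "'c topology" and f'
  assume "spectral_space Z \<and> spectral_wrt X \<U> Z f'"
  then have Z: "spectral_space Z" and f': "f' \<in> X \<rightarrow> topspace Z"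
    and pre: "\<And>W. compact_openin Z W \<Longrightarrow> {x \<in> X. f' x \<in> W} \<in> \<U>"
    by (auto simp: spectral_wrt_def)
  note LY = spectral_space_set_lattice[OF Y] and LZ = spectral_space_set_lattice[OF Z]
  \<comment> \<open>The recurring device: quasi-compact opens of \<open>Y\<close> are equal once
    they have the same trace on \<open>X\<close> along \<open>f\<close>.\<close>
  have inj: "V = V'" if "compact_openin Y V" "compact_openin Y V'"
    "\<And>x. x \<in> X \<Longrightarrow> f x \<in> V \<longleftrightarrow> f x \<in> V'" for V V'
  proof -
    have "{x \<in> X. f x \<in> V} = {x \<in> X. f x \<in> V'}" using that by blast
    then show ?thesis using bij_betw_imp_inj_on[OF bij] that by (auto simp: inj_on_def)
  qed
  have "\<exists>V. compact_openin Y V \<and> (\<forall>x\<in>X. f x \<in> V \<longleftrightarrow> f' x \<in> W)" if W: "compact_openin Z W" for W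
  proof -
    have "{x \<in> X. f' x \<in> W} \<in> (\<lambda>V. {x \<in> X. f x \<in> V}) ` {V. compact_openin Y V}"
      using pre[OF W] bij by (simp add: bij_betw_def)
    then obtain V where "compact_openin Y V" "{x \<in> X. f' x \<in> W} = {x \<in> X. f x \<in> V}" by blast
    then show ?thesis by blast
  qed
  then obtain \<phi> where \<phi>: "\<And>W. compact_openin Z W \<Longrightarrow> compact_openin Y (\<phi> W)"
    "\<And>W x. compact_openin Z W \<Longrightarrow> x \<in> X \<Longrightarrow> f x \<in> \<phi> W \<longleftrightarrow> f' x \<in> W"
    by metis
  have lat: "compact_openin Z (W \<inter> W')" "compact_openin Z (W \<union> W')"
    if "compact_openin Z W" "compact_openin Z W'" for W W'
    using LZ that by (auto simp: set_lattice_def)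
  have latY: "compact_openin Y (W \<inter> W')" "compact_openin Y (W \<union> W')"
    if "compact_openin Y W" "compact_openin Y W'" for W W'
    using LY that by (auto simp: set_lattice_def)
  have top: "compact_openin Z (topspace Z)" "compact_openin Z {}"
    "compact_openin Y (topspace Y)" "compact_openin Y {}"
    using LZ LY by (auto simp: set_lattice_def)
  \<comment> \<open>Although \<phi> is merely chosen, it is a lattice homomorphism: both sides have
    the same trace on \<open>X\<close>.\<close>
  have \<phi>_Int: "\<phi> (W \<inter> W') = \<phi> W \<inter> \<phi> W'" and \<phi>_Un: "\<phi> (W \<union> W') = \<phi> W \<union> \<phi> W'"
    if "compact_openin Z W" "compact_openin Z W'" for W W'
    using that by (intro inj; simp add: \<phi> lat latY)+
  have \<phi>_top: "\<phi> (topspace Z) = topspace Y" and \<phi>_empty: "\<phi> {} = {}"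
    using f f' by (intro inj; simp add: \<phi> top Pi_iff)+
  have "\<exists>z. z \<in> topspace Z \<and> (\<forall>W. compact_openin Z W \<longrightarrow> (z \<in> W \<longleftrightarrow> y \<in> \<phi> W))"
    if y: "y \<in> topspace Y" for y
  proof -
    have "prime_filter (topspace Z) {W. compact_openin Z W} {W. compact_openin Z W \<and> y \<in> \<phi> W}"
      using y by (auto simp: prime_filter_def \<phi>_Int \<phi>_Un \<phi>_top \<phi>_empty lat top)
    then show ?thesis
      using spectral_space_prime_filter_point[OF Z] by (smt (verit) mem_Collect_eq)
  qed
  then obtain g where g: "\<And>y. y \<in> topspace Y \<Longrightarrow> g y \<in> topspace Z"
    "\<And>y W. y \<in> topspace Y \<Longrightarrow> compact_openin Z W \<Longrightarrow> g y \<in> W \<longleftrightarrow> y \<in> \<phi> W"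
    by metis
  let ?g = "restrict g (topspace Y)"
  have \<phi>Y: "\<phi> W \<subseteq> topspace Y" if "compact_openin Z W" for W
    using \<phi>(1)[OF that] openin_subset by (auto simp: compact_openin_def)
  show "\<exists>!g. g \<in> topspace Y \<rightarrow>\<^sub>E topspace Z \<and> spectral_map Y Z g \<and> (\<forall>x\<in>X. f' x = g (f x))"
  proof (intro ex1I[of _ ?g] conjI ballI)
    show gY: "?g \<in> topspace Y \<rightarrow>\<^sub>E topspace Z" using g by auto
    have "{y \<in> topspace Y. ?g y \<in> W} = \<phi> W" if "compact_openin Z W" for W
      using g(2)[OF _ that] \<phi>Y[OF that] by auto
    then show "spectral_map Y Z ?g"
      using g \<phi>(1) by (auto simp: spectral_map_def)
    show "f' x = ?g (f x)" if x: "x \<in> X" for x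
    proof (rule spectral_space_eqI[OF Z])
      show "f' x \<in> W \<longleftrightarrow> ?g (f x) \<in> W" if "compact_openin Z W" for W
        using f x g(2) \<phi>(2) that by auto
    qed (use f f' g x in auto)
    fix h assume h: "h \<in> topspace Y \<rightarrow>\<^sub>E topspace Z \<and> spectral_map Y Z h \<and> (\<forall>x\<in>X. f' x = h (f x))"
    \<comment> \<open>Any factorization \<open>h\<close> has the preimages \<open>\<phi> W\<close>,
      because these are forced by their traces on \<open>X\<close>. Since quasi-compact opens
      separate the points of \<open>Z\<close>, this determines \<open>h\<close>.\<close>
    have pre_h: "{y \<in> topspace Y. h y \<in> W} = \<phi> W" if "compact_openin Z W" for W
      using h f that by (intro inj) (auto simp: \<phi> spectral_map_def)
    show "h = ?g"
    proof (rule PiE_ext[OF conjunct1[OF h] gY])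
      fix y assume y: "y \<in> topspace Y"
      show "h y = ?g y"
      proof (rule spectral_space_eqI[OF Z])
        show "h y \<in> W \<longleftrightarrow> ?g y \<in> W" if "compact_openin Z W" for W
          using pre_h[OF that] g(2)[OF y that] y by auto
      qed (use h g y in auto)
    qed
  qed
qed (rule Y)

section \<open>The space of prime filters\<close>

text \<open>The spectrum of the distributive lattice \<open>B\<close>, with prime filters in place
  of prime ideals. For a lattice of sets the basic opens are closed under intersection, so arbitrary
  unions of them already form a topology.\<close>

definition prime_filter_space :: "'a set \<Rightarrow> 'a set set \<Rightarrow> 'a set set topology" where
  "prime_filter_space S B =
     topology (arbitrary union_of (\<lambda>D. \<exists>u\<in>B. D = {P. prime_filter S B P \<and> u \<in> P}))"

text \<open>These filters are the images of the points of \<open>X\<close> in the spectral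
  closure.\<close>

lemma prime_filter_principal:
  assumes "set_lattice S B" "x \<in> S"
  shows "prime_filter S B {u \<in> B. x \<in> u}"
  using assms by (auto simp: prime_filter_def set_lattice_def)

lemma prime_filter_space_spectral_closure:
  fixes X :: "'a set" and \<U> :: "'a set set"
  assumes L: "set_lattice X \<U>"
  shows "is_spectral_closure TYPE('c) X \<U> (prime_filter_space X \<U>) (\<lambda>x. {u \<in> \<U>. x \<in> u})"
proof -
  let ?T = "prime_filter_space X \<U>"
  define D where "D u = {P. prime_filter X \<U> P \<and> u \<in> P}" for u
  define B where "B = D ` \<U>"
  have UI: "X \<in> \<U>" "{} \<in> \<U>" "\<And>u v. u \<in> \<U> \<Longrightarrow> v \<in> \<U> \<Longrightarrow> u \<inter> v \<in> \<U>"
    "\<And>u v. u \<in> \<U> \<Longrightarrow> v \<in> \<U> \<Longrightarrow> u \<union> v \<in> \<U>" "\<And>u. u \<in> \<U> \<Longrightarrow> u \<subseteq> X"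
    using L by (auto simp: set_lattice_def)
  have D_Int: "D (u \<inter> v) = D u \<inter> D v" and D_Un: "D (u \<union> v) = D u \<union> D v"
    if "u \<in> \<U>" "v \<in> \<U>" for u v
    using that by (auto simp: D_def prime_filter_def)
  have D_top: "D X = {P. prime_filter X \<U> P}" and D_empty: "D {} = {}"
    by (auto simp: D_def prime_filter_def)
  have "istopology (arbitrary union_of (\<lambda>d. d \<in> B))"
  proof (rule istopology_base)
    fix S T assume "S \<in> B" "T \<in> B"
    then show "S \<inter> T \<in> B"
      unfolding B_def using D_Int UI(3) by (metis (no_types, lifting) imageE imageI)
  qed
  moreover have "?T = topology (arbitrary union_of (\<lambda>d. d \<in> B))"
    by (simp add: prime_filter_space_def B_def D_def image_iff)
  ultimately have op: "openin ?T = arbitrary union_of (\<lambda>d. d \<in> B)"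
    by simp
  have top: "topspace ?T = D X"
  proof
    have "d \<subseteq> D X" if "d \<in> B" for d
      using that by (auto simp: B_def D_def prime_filter_def)
    moreover have "(arbitrary union_of (\<lambda>d. d \<in> B)) (topspace ?T)"
      by (metis op openin_topspace)
    ultimately show "topspace ?T \<subseteq> D X"
      unfolding union_of_def by blast
    have "D X \<in> B" using UI by (simp add: B_def)
    then show "D X \<subseteq> topspace ?T"
      by (metis op arbitrary_union_of_inc openin_subset)
  qed
  have LB: "set_lattice (topspace ?T) B"
    unfolding set_lattice_def top
  proof (intro conjI ballI)
    show "B \<subseteq> Pow (D X)" by (auto simp: B_def D_def prime_filter_def)
    show "D X \<in> B" "{} \<in> B" using UI D_empty by (auto simp: B_def image_iff)
    show "u \<inter> v \<in> B" "u \<union> v \<in> B" if uv: "u \<in> B" "v \<in> B" for u v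
    proof -
      obtain u' v' where "u' \<in> \<U>" "v' \<in> \<U>" "u = D u'" "v = D v'" using uv by (auto simp: B_def)
      then show "u \<inter> v \<in> B" "u \<union> v \<in> B"
        using D_Int[of u' v'] D_Un[of u' v'] UI by (auto simp: B_def)
    qed
  qed
  have t0: "P = Q" if P: "P \<in> topspace ?T" and Q: "Q \<in> topspace ?T"
    and eq: "\<And>d. d \<in> B \<Longrightarrow> P \<in> d \<longleftrightarrow> Q \<in> d" for P Q
  proof -
    have pq: "prime_filter X \<U> P" "prime_filter X \<U> Q" using P Q by (auto simp: top D_top)
    then have "u \<in> P \<longleftrightarrow> u \<in> Q" if "u \<in> \<U>" for u
      using eq[of "D u"] that by (auto simp: B_def D_def)
    then show ?thesis using pq by (auto simp: prime_filter_def)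
  qed
  \<comment> \<open>As \<open>D\<close> preserves unions and intersections, a prime filter on the
    basis pulls back along \<open>D\<close> to a prime filter of \<U>, which is itself a point of
    the space and realises the given filter.\<close>
  have pt: "\<exists>z\<in>topspace ?T. \<forall>d\<in>B. z \<in> d \<longleftrightarrow> d \<in> \<P>" if \<P>: "prime_filter (topspace ?T) B \<P>" for \<P>
  proof -
    have DB: "D u \<in> B" if "u \<in> \<U>" for u using that by (simp add: B_def)
    have "prime_filter X \<U> {u \<in> \<U>. D u \<in> \<P>}"
      unfolding prime_filter_def
    proof (intro conjI ballI)
      show "X \<in> {u \<in> \<U>. D u \<in> \<P>}" "{} \<notin> {u \<in> \<U>. D u \<in> \<P>}"
        using \<P> UI(1) unfolding prime_filter_def by (simp_all add: D_empty top)
      fix u v assume uv: "u \<in> \<U>" "v \<in> \<U>"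
      then show "u \<inter> v \<in> {u \<in> \<U>. D u \<in> \<P>} \<longleftrightarrow> u \<in> {u \<in> \<U>. D u \<in> \<P>} \<and> v \<in> {u \<in> \<U>. D u \<in> \<P>}"
        "u \<union> v \<in> {u \<in> \<U>. D u \<in> \<P>} \<longleftrightarrow> u \<in> {u \<in> \<U>. D u \<in> \<P>} \<or> v \<in> {u \<in> \<U>. D u \<in> \<P>}"
        using \<P> DB UI(3,4) unfolding prime_filter_def by (simp_all add: D_Int D_Un)
    qed auto
    moreover from this have "{u \<in> \<U>. D u \<in> \<P>} \<in> topspace ?T" by (simp add: top D_top)
    ultimately show ?thesis
      by (intro bexI) (auto simp: B_def D_def)
  qed
  have sp: "spectral_space ?T" and co: "\<And>V. compact_openin ?T V \<longleftrightarrow> V \<in> B"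
    using spectral_space_of_prime_filters[OF op LB t0 pt]
      compact_openin_of_prime_filters[OF op LB t0 pt] by blast+
  \<comment> \<open>Hence \<open>D\<close> inverts the passage from basic opens to their traces on
    \<open>X\<close>, which is the bijection required.\<close>
  have pre: "{x \<in> X. {u \<in> \<U>. x \<in> u} \<in> D v} = v" if "v \<in> \<U>" for v
    using that UI(5)[OF that] prime_filter_principal[OF L] by (auto simp: D_def)
  have "bij_betw (\<lambda>V. {x \<in> X. {u \<in> \<U>. x \<in> u} \<in> V}) {V. compact_openin ?T V} \<U>"
    by (rule bij_betw_byWitness[where f' = D]) (auto simp: co B_def pre)
  moreover have "(\<lambda>x. {u \<in> \<U>. x \<in> u}) \<in> X \<rightarrow> topspace ?T"
    using prime_filter_principal[OF L] by (auto simp: top D_top)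
  ultimately show ?thesis
    using is_spectral_closureI sp by blast
qed

text \<open>Transports universality for a test type \<open>'c\<close> that may differ from both
  carrier types. A map \<open>g\<close> out of \<open>Y\<close> gives \<open>g\<close> after
  \<open>h\<close> on \<open>Y'\<close>. Conversely a competitor \<open>g'\<close> on
  \<open>Y'\<close> gives \<open>g'\<close> after \<open>k\<close> on \<open>Y\<close>, which must
  agree with \<open>g\<close>; composing with \<open>h\<close> recovers \<open>g'\<close>.\<close>

lemma is_spectral_closure_iso:
  fixes Y :: "'b topology" and Y' :: "'d topology"
  assumes Y: "is_spectral_closure TYPE('c) X \<U> Y f"
    and Y': "spectral_space Y'" "spectral_wrt X \<U> Y' f'"
    and h: "spectral_map Y' Y h" "\<And>x. x \<in> X \<Longrightarrow> h (f' x) = f x"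
    and k: "spectral_map Y Y' k" "\<And>y. y \<in> topspace Y' \<Longrightarrow> k (h y) = y"
  shows "is_spectral_closure TYPE('c) X \<U> Y' f'"
  unfolding is_spectral_closure_def
proof (intro conjI allI impI)
  fix Z :: "'c topology" and e
  assume "spectral_space Z \<and> spectral_wrt X \<U> Z e"
  then have Ze: "spectral_space Z" "spectral_wrt X \<U> Z e" by auto
  then obtain g where g: "g \<in> topspace Y \<rightarrow>\<^sub>E topspace Z" "spectral_map Y Z g" "\<And>x. x \<in> X \<Longrightarrow> e x = g (f x)"
    using is_spectral_closureD[OF Y Ze] by blast
  let ?g = "restrict (\<lambda>y. g (h y)) (topspace Y')"
  have f': "f' \<in> X \<rightarrow> topspace Y'" using Y' by (simp add: spectral_wrt_def)
  have hk: "h \<in> topspace Y' \<rightarrow> topspace Y" using h by (simp add: spectral_map_def)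
  have kf: "k (f x) = f' x" if "x \<in> X" for x
    using that f' h(2) k(2) by (metis PiE)
  show "\<exists>!g. g \<in> topspace Y' \<rightarrow>\<^sub>E topspace Z \<and> spectral_map Y' Z g \<and> (\<forall>x\<in>X. e x = g (f' x))"
  proof (intro ex1I[of _ ?g] conjI ballI)
    show gY: "?g \<in> topspace Y' \<rightarrow>\<^sub>E topspace Z" using g hk by auto
    show "spectral_map Y' Z ?g" by (rule spectral_map_compose[OF h(1) g(2)]) simp
    show "e x = ?g (f' x)" if "x \<in> X" for x
      using that f' h(2) g(3) by auto
    fix g' assume g': "g' \<in> topspace Y' \<rightarrow>\<^sub>E topspace Z \<and> spectral_map Y' Z g' \<and> (\<forall>x\<in>X. e x = g' (f' x))"
    then have "spectral_map Y' Z g'" by blast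
    then have "spectral_map Y Z (\<lambda>y. g' (k y))" by (rule spectral_map_compose[OF k(1)]) simp
    then have "g' (k y) = g y" if "y \<in> topspace Y" for y
      by (rule spectral_wrt_eq_compose[OF Y Ze _ g(2) _ g(3)[symmetric] that]) (simp add: kf g')
    then have "g' y = g (h y)" if "y \<in> topspace Y'" for y
      using that hk k(2) by (metis PiE)
    then show "g' = ?g"
      using g' gY by (intro PiE_ext[of g' "topspace Y'"]) auto
  qed
qed (use Y' in auto)

lemma spectral_closure_is_spectral_closure:
  fixes X :: "'a set" and \<U> :: "'a set set"
  assumes L: "set_lattice X \<U>"
  shows "is_spectral_closure TYPE('c) X \<U> (spectral_closure X \<U>) (spectral_closure_map X \<U>)"
proof -
  note P = prime_filter_space_spectral_closure[OF L]
  have "\<exists>p :: 'a set set topology \<times> ('a \<Rightarrow> 'a set set). is_spectral_closure TYPE('a set set) X \<U> (fst p) (snd p)"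
    by (rule exI[of _ "(prime_filter_space X \<U>, \<lambda>x. {u \<in> \<U>. x \<in> u})"]) (simp add: P)
  then have C: "is_spectral_closure TYPE('a set set) X \<U> (spectral_closure X \<U>) (spectral_closure_map X \<U>)"
    unfolding spectral_closure_def spectral_closure_map_def spectral_closure_pair_def by (rule someI_ex)
  show ?thesis
  \<comment> \<open>Both carriers have type \<open>'a set set\<close>, so the universality of the
    chosen pair for this one type is enough to compare it with the space of prime filters.
    Universality for \<open>'c\<close> is then carried across.\<close>
  proof (rule spectral_closure_iso[OF C C P P])
    fix h k
    assume "spectral_map (spectral_closure X \<U>) (prime_filter_space X \<U>) h"
      "\<And>x. x \<in> X \<Longrightarrow> h (spectral_closure_map X \<U> x) = {u \<in> \<U>. x \<in> u}"
      "spectral_map (prime_filter_space X \<U>) (spectral_closure X \<U>) k"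
      "\<And>y. y \<in> topspace (spectral_closure X \<U>) \<Longrightarrow> k (h y) = y"
    moreover have "spectral_space (spectral_closure X \<U>)"
      "spectral_wrt X \<U> (spectral_closure X \<U>) (spectral_closure_map X \<U>)"
      using C by (simp_all add: is_spectral_closure_def)
    ultimately show ?thesis by (intro is_spectral_closure_iso[OF P])
  qed
qed

section \<open>Constructible closures\<close>

lemma topspace_constructible [simp]:
  assumes "spectral_space T"
  shows "topspace (constructible_topology T) = topspace T"
  using spectral_space_set_lattice[OF assms]
  unfolding constructible_topology_def topology_generated_by_topspace set_lattice_def by blast

text \<open>Differences of quasi-compact opens include the generators, as \<open>V - {}\<close> and
  \<open>topspace T - V\<close>, and are closed under intersection:
  \<open>(V - W) \<inter> (V' - W')\<close> equals \<open>(V \<inter> V') - (W \<union> W')\<close>.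
  So they form a basis, not only a subbasis.\<close>

lemma openin_constructible_basis:
  assumes T: "spectral_space T" and U: "openin (constructible_topology T) U" "x \<in> U"
  obtains V W where "compact_openin T V" "compact_openin T W" "x \<in> V - W" "V - W \<subseteq> U"
proof -
  let ?G = "{V. compact_openin T V} \<union> {topspace T - V | V. compact_openin T V}"
  have lat: "compact_openin T (topspace T)" "compact_openin T {}"
    "\<And>V W. compact_openin T V \<Longrightarrow> compact_openin T W \<Longrightarrow> compact_openin T (V \<inter> W)"
    "\<And>V W. compact_openin T V \<Longrightarrow> compact_openin T W \<Longrightarrow> compact_openin T (V \<union> W)"
    using spectral_space_set_lattice[OF T] by (auto simp: set_lattice_def)
  have "generate_topology_on ?G U"
    using U(1) by (simp add: constructible_topology_def openin_topology_generated_by_iff)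
  then have "\<forall>x\<in>U. \<exists>V W. compact_openin T V \<and> compact_openin T W \<and> x \<in> V - W \<and> V - W \<subseteq> U"
  proof induction
    case (Int a b)
    show ?case
    proof
      fix x assume "x \<in> a \<inter> b"
      then have x: "x \<in> a" "x \<in> b" by auto
      obtain V W where "compact_openin T V" "compact_openin T W" "x \<in> V - W" "V - W \<subseteq> a"
        using bspec[OF Int.IH(1) x(1)] by (elim exE conjE)
      moreover obtain V' W' where
        "compact_openin T V'" "compact_openin T W'" "x \<in> V' - W'" "V' - W' \<subseteq> b"
        using bspec[OF Int.IH(2) x(2)] by (elim exE conjE)
      ultimately have "compact_openin T (V \<inter> V')" "compact_openin T (W \<union> W')"
        "x \<in> (V \<inter> V') - (W \<union> W')" "(V \<inter> V') - (W \<union> W') \<subseteq> a \<inter> b"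
        using lat by auto
      then show "\<exists>V W. compact_openin T V \<and> compact_openin T W \<and> x \<in> V - W \<and> V - W \<subseteq> a \<inter> b"
        by blast
    qed
  next
    case (UN K)
    then show ?case by (meson Sup_upper UnionE subset_trans)
  next
    case (Basis s)
    then show ?case using lat(1,2) by blast
  qed auto
  then show ?thesis using that U(2) by blast
qed

lemma constructible_openin_diff:
  assumes "compact_openin T V" "compact_openin T W"
  shows "openin (constructible_topology T) (V - W)"
proof -
  have "openin (constructible_topology T) V" "openin (constructible_topology T) (topspace T - W)"
    using assms unfolding constructible_topology_def by (auto intro: topology_generated_by_Basis)
  moreover have "V - W = V \<inter> (topspace T - W)"
    using assms openin_subset by (fastforce simp: compact_openin_def)
  ultimately show ?thesis by (metis openin_Int)
qed

lemma in_constructible_closure_of: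
  assumes "spectral_space T"
  shows "x \<in> constructible_topology T closure_of A \<longleftrightarrow> x \<in> topspace T \<and>
    (\<forall>V W. compact_openin T V \<and> compact_openin T W \<and> x \<in> V - W \<longrightarrow> (V - W) \<inter> A \<noteq> {})"
proof
  assume "x \<in> constructible_topology T closure_of A"
  then have "x \<in> topspace T" and cl: "\<And>U. x \<in> U \<Longrightarrow> openin (constructible_topology T) U \<Longrightarrow> U \<inter> A \<noteq> {}"
    using assms by (auto simp: in_closure_of)
  then show "x \<in> topspace T \<and>
    (\<forall>V W. compact_openin T V \<and> compact_openin T W \<and> x \<in> V - W \<longrightarrow> (V - W) \<inter> A \<noteq> {})"
    by (intro conjI allI impI) (assumption, elim conjE, rule cl[OF _ constructible_openin_diff])
next
  assume R: "x \<in> topspace T \<and>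
    (\<forall>V W. compact_openin T V \<and> compact_openin T W \<and> x \<in> V - W \<longrightarrow> (V - W) \<inter> A \<noteq> {})"
  have "\<exists>y. y \<in> A \<and> y \<in> U" if U: "openin (constructible_topology T) U" "x \<in> U" for U
  proof -
    obtain V W where VW: "compact_openin T V" "compact_openin T W" "x \<in> V - W" and "V - W \<subseteq> U"
      by (rule openin_constructible_basis[OF assms U])
    moreover have "(V - W) \<inter> A \<noteq> {}" using R VW by simp
    ultimately show ?thesis by blast
  qed
  then show "x \<in> constructible_topology T closure_of A"
    using R assms by (simp add: in_closure_of)
qed

lemma constructible_closure_spectral_closure:
  assumes X': "spectral_space X'" and i: "i \<in> X \<rightarrow> topspace X'"
    and \<U>: "\<U> = {{x \<in> X. i x \<in> V} | V. compact_openin X' V}"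
  shows "is_spectral_closure TYPE('c) X \<U> (subtopology X' (constructible_topology X' closure_of (i ` X))) i"
proof -
  define K where "K = constructible_topology X' closure_of (i ` X)"
  let ?T = "subtopology X' K"
  define B where "B = (\<lambda>V. V \<inter> K) ` {V. compact_openin X' V}"
  have KT: "K \<subseteq> topspace X'" and top: "topspace ?T = K"
    using closure_of_subset_topspace[of "constructible_topology X'" "i ` X"] X' by (auto simp: K_def)
  have iK: "i ` X \<subseteq> K"
    unfolding K_def using closure_of_subset[of "i ` X" "constructible_topology X'"] i X' by auto
  \<comment> \<open>Density of the image in \<open>K\<close> for the constructible topology. It is
    used twice: to place the realising point in \<open>K\<close>, and to recover traces on
    \<open>K\<close> from traces on \<open>X\<close>.\<close>
  have K_meets: "\<exists>x\<in>X. i x \<in> V - W"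
    if "compact_openin X' V" "compact_openin X' W" "z \<in> V - W" "z \<in> K" for z V W
    using that unfolding K_def in_constructible_closure_of[OF X'] by blast
  have lat: "compact_openin X' (topspace X')" "compact_openin X' {}"
    "\<And>V W. compact_openin X' V \<Longrightarrow> compact_openin X' W \<Longrightarrow> compact_openin X' (V \<inter> W)"
    "\<And>V W. compact_openin X' V \<Longrightarrow> compact_openin X' W \<Longrightarrow> compact_openin X' (V \<union> W)"
    using spectral_space_set_lattice[OF X'] by (auto simp: set_lattice_def)
  have inB: "V \<inter> K \<in> B" if "compact_openin X' V" for V
    using that by (simp add: B_def)
  have op: "openin ?T = arbitrary union_of (\<lambda>d. d \<in> B)"
  proof
    fix S
    show "openin ?T S = (arbitrary union_of (\<lambda>d. d \<in> B)) S"
    proof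
      assume "openin ?T S"
      then obtain V where V: "openin X' V" "S = V \<inter> K" by (auto simp: openin_subtopology)
      then have "\<exists>d. d \<in> B \<and> y \<in> d \<and> d \<subseteq> S" if "y \<in> S" for y
        using that spectral_space_basis[OF X' V(1), of y] inB by (metis IntD1 IntD2 IntI Int_mono subset_refl)
      then show "(arbitrary union_of (\<lambda>d. d \<in> B)) S"
        by (subst arbitrary_union_of_alt) blast
    next
      assume "(arbitrary union_of (\<lambda>d. d \<in> B)) S"
      then obtain \<D> where "\<D> \<subseteq> B" "S = \<Union>\<D>" by (auto simp: union_of_def)
      then show "openin ?T S"
        by (auto simp: B_def openin_subtopology_Int compact_openin_def intro!: openin_Union)
    qed
  qed
  have LB: "set_lattice (topspace ?T) B"
    unfolding set_lattice_def top
  proof (intro conjI ballI)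
    show "B \<subseteq> Pow K" by (auto simp: B_def)
    show "K \<in> B" "{} \<in> B" using inB[OF lat(1)] inB[OF lat(2)] KT by (simp_all add: Int_absorb1)
    fix u v assume "u \<in> B" "v \<in> B"
    then obtain V W where VW: "compact_openin X' V" "compact_openin X' W" "u = V \<inter> K" "v = W \<inter> K"
      by (auto simp: B_def)
    then have "u \<inter> v = (V \<inter> W) \<inter> K" "u \<union> v = (V \<union> W) \<inter> K" by auto
    then show "u \<inter> v \<in> B" "u \<union> v \<in> B" using inB lat VW by simp_all
  qed
  have t0: "x = y" if "x \<in> topspace ?T" "y \<in> topspace ?T" "\<And>d. d \<in> B \<Longrightarrow> x \<in> d \<longleftrightarrow> y \<in> d" for x y
    by (rule spectral_space_eqI[OF X']) (use that KT inB top in blast)+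
  have pt: "\<exists>z\<in>topspace ?T. \<forall>d\<in>B. z \<in> d \<longleftrightarrow> d \<in> \<P>" if \<P>: "prime_filter (topspace ?T) B \<P>" for \<P>
  proof -
    \<comment> \<open>The given filter lives on traces on \<open>K\<close>; it is pulled back to the
      quasi-compact opens of \<open>X'\<close>, where sobriety provides a point.\<close>
    define P where "P = {V. compact_openin X' V \<and> V \<inter> K \<in> \<P>}"
    have IU: "(V \<inter> W) \<inter> K = (V \<inter> K) \<inter> (W \<inter> K)" "(V \<union> W) \<inter> K = (V \<inter> K) \<union> (W \<inter> K)" for V W
      by auto
    have "prime_filter (topspace X') {V. compact_openin X' V} P"
      unfolding prime_filter_def
    proof (intro conjI ballI)
      show "topspace X' \<in> P" "{} \<notin> P"
        using \<P> KT lat unfolding P_def prime_filter_def top by (simp_all add: Int_absorb1)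
      fix V W assume "V \<in> {V. compact_openin X' V}" "W \<in> {V. compact_openin X' V}"
      then show "V \<inter> W \<in> P \<longleftrightarrow> V \<in> P \<and> W \<in> P" "V \<union> W \<in> P \<longleftrightarrow> V \<in> P \<or> W \<in> P"
        using \<P> lat inB unfolding P_def prime_filter_def by (simp_all add: IU)
    qed (auto simp: P_def)
    then obtain z where z: "z \<in> topspace X'" "\<And>V. compact_openin X' V \<Longrightarrow> z \<in> V \<longleftrightarrow> V \<inter> K \<in> \<P>"
      using spectral_space_prime_filter_point[OF X'] by (smt (verit) P_def mem_Collect_eq)
    have "(V - W) \<inter> i ` X \<noteq> {}" if VW: "compact_openin X' V" "compact_openin X' W" "z \<in> V - W" for V W
    proof -
      have "V \<inter> K \<in> \<P>" "W \<inter> K \<notin> \<P>" using z VW by auto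
      \<comment> \<open>Inclusion would put \<open>W \<inter> K\<close> into the filter by upward
        closure. Thus \<open>V - W\<close> contains a point of \<open>K\<close>, and hence a point
        of the image of \<open>i\<close>.\<close>
      then have "\<not> V \<inter> K \<subseteq> W \<inter> K" using prime_filter_mono[OF \<P>] inB VW by blast
      then show ?thesis using K_meets[OF VW(1,2)] by blast
    qed
    then have "z \<in> K" unfolding K_def in_constructible_closure_of[OF X'] using z(1) by blast
    then show ?thesis using z by (intro bexI[of _ z]) (auto simp: B_def)
  qed
  have sp: "spectral_space ?T" and co: "\<And>V. compact_openin ?T V \<longleftrightarrow> V \<in> B"
    using spectral_space_of_prime_filters[OF op LB t0 pt]
      compact_openin_of_prime_filters[OF op LB t0 pt] by blast+
  \<comment> \<open>A point of \<open>K\<close> in \<open>V - W\<close> would yield some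
    \<open>x\<close> in \<open>X\<close> with \<open>i x \<in> V - W\<close>, at which the two
    traces differ.\<close>
  have sub: "V \<inter> K \<subseteq> W" if "compact_openin X' V" "compact_openin X' W"
    "{x \<in> X. i x \<in> V \<inter> K} = {x \<in> X. i x \<in> W \<inter> K}" for V W
    using K_meets[OF that(1,2)] that(3) iK by blast
  have "bij_betw (\<lambda>V. {x \<in> X. i x \<in> V}) {V. compact_openin ?T V} \<U>"
    unfolding bij_betw_def
  proof
    show "inj_on (\<lambda>V. {x \<in> X. i x \<in> V}) {V. compact_openin ?T V}"
    proof (rule inj_onI)
      fix d e assume "d \<in> {V. compact_openin ?T V}" "e \<in> {V. compact_openin ?T V}"
        and eq: "{x \<in> X. i x \<in> d} = {x \<in> X. i x \<in> e}"
      then obtain V W where VW: "compact_openin X' V" "compact_openin X' W" "d = V \<inter> K" "e = W \<inter> K"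
        by (auto simp: co B_def)
      then show "d = e"
        using sub[of V W] sub[of W V] eq by blast
    qed
    have "{x \<in> X. i x \<in> V \<inter> K} = {x \<in> X. i x \<in> V}" for V using iK by blast
    then show "(\<lambda>V. {x \<in> X. i x \<in> V}) ` {V. compact_openin ?T V} = \<U>"
      by (simp add: co B_def \<U> image_image) blast
  qed
  moreover have "i \<in> X \<rightarrow> topspace ?T" using iK top by auto
  ultimately show ?thesis
    using is_spectral_closureI sp unfolding K_def by blast
qed

theorem theorem2p8:
  fixes X :: "'a set" and \<U> :: "'a set set"
  assumes "\<U> \<subseteq> Pow X" and "\<U> \<noteq> {}"
    and "\<And>\<F>. finite \<F> \<Longrightarrow> \<F> \<subseteq> \<U> \<Longrightarrow> X \<inter> \<Inter>\<F> \<in> \<U>"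
    and "\<And>\<F>. finite \<F> \<Longrightarrow> \<F> \<subseteq> \<U> \<Longrightarrow> \<Union>\<F> \<in> \<U>"
  shows
    "is_spectral_closure TYPE('c) X \<U> (spectral_closure X \<U>) (spectral_closure_map X \<U>) \<and>
     (\<forall>(Y :: 'b topology) f (Z :: 'd topology) g.
        is_spectral_closure TYPE('b) X \<U> Y f \<and> is_spectral_closure TYPE('d) X \<U> Y f \<and>
        is_spectral_closure TYPE('b) X \<U> Z g \<and> is_spectral_closure TYPE('d) X \<U> Z g \<longrightarrow>
        (\<exists>!h. h \<in> topspace Y \<rightarrow>\<^sub>E topspace Z \<and> homeomorphic_map Y Z h \<and> (\<forall>x\<in>X. g x = h (f x)))) \<and>
     (\<forall>(X' :: 'e topology) i.
        spectral_space X' \<and> i \<in> X \<rightarrow> topspace X' \<and>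
        \<U> = {{x \<in> X. i x \<in> V} | V. compact_openin X' V} \<longrightarrow>
        is_spectral_closure TYPE('c) X \<U>
          (subtopology X' (constructible_topology X' closure_of (i ` X))) i)"
proof -
  \<comment> \<open>Empty families supply \<open>X\<close> and the empty set, since
    \<open>X \<inter> \<Inter>{}\<close> is \<open>X\<close>; two-element families supply the binary
    operations.\<close>
  have "X \<inter> \<Inter>{} \<in> \<U>" "\<Union>{} \<in> \<U>" using assms(3,4) by blast+
  moreover have "u \<inter> v \<in> \<U>" "u \<union> v \<in> \<U>" if "u \<in> \<U>" "v \<in> \<U>" for u v
  proof -
    have "X \<inter> \<Inter>{u, v} \<in> \<U>" "\<Union>{u, v} \<in> \<U>" using that assms(3,4)[of "{u, v}"] by auto
    moreover have "X \<inter> \<Inter>{u, v} = u \<inter> v" using that assms(1) by auto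
    ultimately show "u \<inter> v \<in> \<U>" "u \<union> v \<in> \<U>" by auto
  qed
  ultimately have L: "set_lattice X \<U>" using assms(1) by (simp add: set_lattice_def)
  show ?thesis
    by (intro conjI allI impI; (elim conjE)?)
      (rule spectral_closure_is_spectral_closure[OF L] spectral_closure_unique
        constructible_closure_spectral_closure; assumption)+
qed

end
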